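(* Let $f,G,C,D,\mathcal F$ be as in the context, assume that every point of $\mathcal F$ is AM-regular, and let $\mathcal A:\mathbb R^n\to\mathbb R^n$ be a constraint dissolving mapping. Let $\{x^k\}$ be an infinite sequence generated by the constraint dissolving inexact penalty method (with associated vectors $\varepsilon^{k}$ and penalty parameters $\beta_k$), where $\varepsilon^k\to 0$ and $\beta_k\to\infty$. If $\bar x$ is an accumulation point of $\{x^k\}$ with $\bar x\in\mathcal F$, then $\bar x$ is an M-stationary point of the problem $\min f(x)$ s.t. $G(x)\in C$, $x\in D$; that is, there exists $\lambda\in\mathcal N_C(G(\bar x))$ with $0\in\nabla f(\bar x)+\nabla G(\bar x)^T\lambda+\mathcal N_D^{\lim}(\bar x)$.
   Context: Setting: $f:\mathbb R^n\to\mathbb R$ and $G:\mathbb R^n\to\mathbb R^m$ are continuously differentiable, $C\subset\mathbb R^m$ is nonempty, closed and convex, $D\subset\mathbb R^n$ is nonempty and closed (not necessarily convex), and $\mathcal F:=\{x\in D: G(x)\in C\}$. $\nabla f(x)\in\mathbb R^n$ is the gradient, $\nabla G(x)\in\mathbb R^{m\times n}$ and $\nabla\mathcal A(x)\in\mathbb R^{n\times n}$ are Jacobians. $P_C$ is the Euclidean projection onto $C$ and $\operatorname{dist}_C$ the Euclidean distance to $C$. Sums of sets are Minkowski sums; $M S:=\{Ms:s\in S\}$ for a matrix $M$ and a set $S$. Normal cones: for a closed set $S$ and $z\in S$, $\mathcal N_S(z):=\{v:\langle v,x-z\rangle\le o(\|x-z\|)\text{ for }x\in S\}$ and $\mathcal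 N_S^{\lim}(z):=\{v:\exists z^k\to z,\ z^k\in S,\ v^k\to v,\ v^k\in\mathcal N_S(z^k)\}$; both are empty if $z\notin S$. For convex $C$ these coincide with the usual normal cone of convex analysis. AM-regularity: $\bar x\in\mathcal F$ is AM-regular if $\limsup_{x\to\bar x,\,z\to0}\mathcal M(x,z)\subset\mathcal M(\bar x,0)$, where $\mathcal M(x,z):=\nabla G(x)^T\mathcal N_C(G(x)-z)+\mathcal N_D^{\lim}(x)$ and $\limsup$ is the Painlevé–Kuratowski outer limit (all limits of sequences $\xi^k\in\mathcal M(x^k,z^k)$ with $x^k\to\bar x$, $z^k\to0$). Constraint dissolving mapping: $\mathcal A:\mathbb R^n\to\mathbb R^n$ such that (a) $\mathcal A$ is continuously differentiable; (b) $\mathcal A(x)=x$ for all $x\in\mathcal F$; (c) $\nabla\mathcal A(x)^T\nabla G(x)^T\mathcal N_C(G(x))=\{0\}$ for all $x\in\mathcal F$; and there exists a continuous mapping $\mathcal R_{\mathcal A}:D\to\mathbb R^{n\times n}$ such that (d) $\mathcal R_{\mathcal A}(x)=0$ for all $x\in\mathcal F$; (e) for every $x\in\mathcal F$ there is $\omega_x>0$ with $(\nabla\mathcal A(y)-I_n-\mathcal R_{\mathcal A}(y))^T\mathcal N_D^{\lim}(y)=\{0\}$ for all $y\in D$ with $\|y-x\|\le\omega_x$. Constraint dissolving inexact penalty method: let $h_\beta(x):=f(\mathcal A(x))+\frac{\beta}{2}\operatorname{dist}_C^2(G(x))$, so $\nabla h_\beta(x)=\nabla\mathcal A(x)^T\nabla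 f(\mathcal A(x))+\beta\nabla G(x)^T(G(x)-P_C(G(x)))$. Start with $\beta_0>0$ and $x^0\in D$. For $k=0,1,2,\dots$, choose $x^{k+1}\in D$ and $\varepsilon^{k+1}\in\mathbb R^n$ with $\varepsilon^{k+1}\in\nabla h_{\beta_k}(x^{k+1})+\mathcal N_D^{\lim}(x^{k+1})$, and then choose $\beta_{k+1}\ge\beta_k$. *)

theory Defs
  imports "HOL-Analysis.Analysis"
begin

definition continuously_differentiable ::
    "('a::real_normed_vector \<Rightarrow> 'b::real_normed_vector) \<Rightarrow> bool" where
  "continuously_differentiable g \<longleftrightarrow>
     (\<exists>g' :: 'a \<Rightarrow> 'a \<Rightarrow>\<^sub>L 'b.
        (\<forall>x. (g has_derivative blinfun_apply (g' x)) (at x)) \<and> continuous_on UNIV g')"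

text \<open>Meaningful only where \<open>f\<close> is differentiable.\<close>

definition gradient :: "(real ^ 'n \<Rightarrow> real) \<Rightarrow> real ^ 'n \<Rightarrow> real ^ 'n" where
  "gradient f x = (THE v. GDERIV f x :> v)"

abbreviation jac :: "(real ^ 'n \<Rightarrow> real ^ 'm) \<Rightarrow> real ^ 'n \<Rightarrow> real ^ 'n ^ 'm" where
  "jac g x \<equiv> jacobian g (at x)"

definition feasible ::
    "(real ^ 'n \<Rightarrow> real ^ 'm) \<Rightarrow> (real ^ 'm) set \<Rightarrow> (real ^ 'n) set \<Rightarrow> (real ^ 'n) set" where
  "feasible G C D = {x \<in> D. G x \<in> C}"

definition normal_cone :: "'a::real_inner set \<Rightarrow> 'a \<Rightarrow> 'a set" where
  "normal_cone S z =
     {v. z \<in> S \<and>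
         (\<forall>\<epsilon>>0. \<exists>\<delta>>0. \<forall>x\<in>S. norm (x - z) < \<delta> \<longrightarrow> v \<bullet> (x - z) \<le> \<epsilon> * norm (x - z))}"

definition lim_normal_cone :: "'a::real_inner set \<Rightarrow> 'a \<Rightarrow> 'a set" where
  "lim_normal_cone S z =
     {v. z \<in> S \<and>
         (\<exists>zs vs. zs \<longlonglongrightarrow> z \<and> vs \<longlonglongrightarrow> v \<and> (\<forall>k. zs k \<in> S \<and> vs k \<in> normal_cone S (zs k)))}"

text \<open>The image \<open>M S\<close> of a set under a matrix.\<close>

definition mat_image :: "real ^ 'n ^ 'm \<Rightarrow> (real ^ 'n) set \<Rightarrow> (real ^ 'm) set" where
  "mat_image M S = (\<lambda>s. M *v s) ` S"

text \<open>The Painleve--Kuratowski outer limit of a set-valued map at a point.  The point itself is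
  allowed as a value of the approximating sequence.\<close>

definition outer_limit ::
    "('a::topological_space \<Rightarrow> 'b::topological_space set) \<Rightarrow> 'a \<Rightarrow> 'b set" where
  "outer_limit \<Phi> p = {\<xi>. \<exists>ps \<xi>s. ps \<longlonglongrightarrow> p \<and> \<xi>s \<longlonglongrightarrow> \<xi> \<and> (\<forall>k. \<xi>s k \<in> \<Phi> (ps k))}"

definition M_map ::
    "(real ^ 'n \<Rightarrow> real ^ 'm) \<Rightarrow> (real ^ 'm) set \<Rightarrow> (real ^ 'n) set \<Rightarrow>
     (real ^ 'n) \<times> (real ^ 'm) \<Rightarrow> (real ^ 'n) set" where
  "M_map G C D = (\<lambda>(x, z).
     mat_image (transpose (jac G x)) (normal_cone C (G x - z)) + lim_normal_cone D x)"

definition AM_regular ::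
    "(real ^ 'n \<Rightarrow> real ^ 'm) \<Rightarrow> (real ^ 'm) set \<Rightarrow> (real ^ 'n) set \<Rightarrow> real ^ 'n \<Rightarrow> bool" where
  "AM_regular G C D x \<longleftrightarrow>
     x \<in> feasible G C D \<and> outer_limit (M_map G C D) (x, 0) \<subseteq> M_map G C D (x, 0)"

definition constraint_dissolving ::
    "(real ^ 'n \<Rightarrow> real ^ 'm) \<Rightarrow> (real ^ 'm) set \<Rightarrow> (real ^ 'n) set \<Rightarrow>
     (real ^ 'n \<Rightarrow> real ^ 'n) \<Rightarrow> bool" where
  "constraint_dissolving G C D A \<longleftrightarrow>
     continuously_differentiable A \<and>
     (\<forall>x \<in> feasible G C D. A x = x) \<and>
     (\<forall>x \<in> feasible G C D.
        mat_image (transpose (jac A x))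
          (mat_image (transpose (jac G x)) (normal_cone C (G x))) = {0}) \<and>
     (\<exists>R :: real ^ 'n \<Rightarrow> real ^ 'n ^ 'n.
        continuous_on D R \<and>
        (\<forall>x \<in> feasible G C D. R x = 0) \<and>
        (\<forall>x \<in> feasible G C D. \<exists>\<omega>>0. \<forall>y\<in>D. norm (y - x) \<le> \<omega> \<longrightarrow>
           mat_image (transpose (jac A y - mat 1 - R y)) (lim_normal_cone D y) = {0}))"

definition penalty_fun ::
    "(real ^ 'n \<Rightarrow> real) \<Rightarrow> (real ^ 'n \<Rightarrow> real ^ 'm) \<Rightarrow> (real ^ 'm) set \<Rightarrow>
     (real ^ 'n \<Rightarrow> real ^ 'n) \<Rightarrow> real \<Rightarrow> real ^ 'n \<Rightarrow> real" where
  "penalty_fun f G C A \<beta> x = f (A x) + \<beta> / 2 * (infdist (G x) C)\<^sup>2"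

text \<open>The value \<open>eps 0\<close> is unconstrained.\<close>

definition generated_by_CDIPM ::
    "(real ^ 'n \<Rightarrow> real) \<Rightarrow> (real ^ 'n \<Rightarrow> real ^ 'm) \<Rightarrow> (real ^ 'm) set \<Rightarrow> (real ^ 'n) set \<Rightarrow>
     (real ^ 'n \<Rightarrow> real ^ 'n) \<Rightarrow> (nat \<Rightarrow> real ^ 'n) \<Rightarrow> (nat \<Rightarrow> real ^ 'n) \<Rightarrow>
     (nat \<Rightarrow> real) \<Rightarrow> bool" where
  "generated_by_CDIPM f G C D A x eps \<beta> \<longleftrightarrow>
     \<beta> 0 > 0 \<and> x 0 \<in> D \<and>
     (\<forall>k. x (Suc k) \<in> D \<and>
          eps (Suc k) \<in>
            {gradient (penalty_fun f G C A (\<beta> k)) (x (Suc k))} + lim_normal_cone D (x (Suc k)) \<and>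
          \<beta> (Suc k) \<ge> \<beta> k)"

definition accumulation_point :: "(nat \<Rightarrow> 'a::metric_space) \<Rightarrow> 'a \<Rightarrow> bool" where
  "accumulation_point x l \<longleftrightarrow> (\<exists>r. strict_mono (r :: nat \<Rightarrow> nat) \<and> (x \<circ> r) \<longlonglongrightarrow> l)"

definition M_stationary ::
    "(real ^ 'n \<Rightarrow> real) \<Rightarrow> (real ^ 'n \<Rightarrow> real ^ 'm) \<Rightarrow> (real ^ 'm) set \<Rightarrow> (real ^ 'n) set \<Rightarrow>
     real ^ 'n \<Rightarrow> bool" where
  "M_stationary f G C D x \<longleftrightarrow>
     (\<exists>lam \<in> normal_cone C (G x).
        0 \<in> {gradient f x + transpose (jac G x) *v lam} + lim_normal_cone D x)"

lemma gradient_eqI: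
  assumes "GDERIV f x :> v"
  shows "gradient f x = v"
  unfolding gradient_def
proof (rule the_equality)
  fix w assume "GDERIV f x :> w"
  then have "(\<lambda>h. h \<bullet> w) = (\<lambda>h. h \<bullet> v)"
    using assms unfolding gderiv_def by (rule has_derivative_unique)
  then show "w = v" by (simp only: fun_eq_iff vector_eq_ldot)
qed (fact assms)

lemma GDERIV_infdist_sq:
  fixes C :: "'a::euclidean_space set"
  assumes "closed C" "convex C" "C \<noteq> {}"
  shows "GDERIV (\<lambda>y. (infdist y C)\<^sup>2) x :> 2 *\<^sub>R (x - closest_point C x)"
proof -
  define p where "p = closest_point C"
  have inf: "infdist y C = norm (y - p y)" for y
    by (simp add: p_def infdist_eq_setdist setdist_closest_point[OF assms(1,3)] dist_norm)
  have pC: "p y \<in> C" for y using assms(1,3) by (simp add: p_def closest_point_in_set)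
  have le: "(norm (y - p y))\<^sup>2 \<le> (norm (y - c))\<^sup>2" if "c \<in> C" for y c
    using closest_point_le[OF assms(1) that, of y] by (simp add: p_def dist_norm)
  have lip: "norm (p y - p x) \<le> norm (y - x)" for y
    using closest_point_lipschitz[OF assms(2,1,3), of y x] by (simp add: p_def dist_norm)
  define e where "e y = (norm (y - p y))\<^sup>2 - (norm (x - p x))\<^sup>2 - 2 * ((y - x) \<bullet> (x - p x))" for y
  have up: "e y \<le> (norm (y - x))\<^sup>2" for y
  proof -
    have "(norm (y - p x))\<^sup>2 = (norm (y - x))\<^sup>2 + 2 * ((y - x) \<bullet> (x - p x)) + (norm (x - p x))\<^sup>2"
      unfolding power2_norm_eq_inner by (simp add: algebra_simps inner_commute)
    with le[OF pC, of y x] show ?thesis unfolding e_def by linarith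
  qed
  have lo: "- 2 * (norm (y - x))\<^sup>2 \<le> e y" for y
  proof -
    have eq: "(norm (y - p y))\<^sup>2 - (norm (x - p y))\<^sup>2 - 2 * ((y - x) \<bullet> (x - p x)) =
        (norm (y - x))\<^sup>2 - 2 * ((y - x) \<bullet> (p y - p x))"
      unfolding power2_norm_eq_inner by (simp add: algebra_simps inner_commute)
    have "(y - x) \<bullet> (p y - p x) \<le> norm (y - x) * norm (p y - p x)"
      by (rule norm_cauchy_schwarz)
    also have "\<dots> \<le> (norm (y - x))\<^sup>2"
      using lip[of y] by (simp add: power2_eq_square mult_left_mono)
    finally show ?thesis
      using le[OF pC, of x y] eq zero_le_power2[of "norm (y - x)"] unfolding e_def by linarith
  qed
  have "norm (e y) \<le> 2 * (norm (y - x))\<^sup>2" for y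
    using up[of y] lo[of y] zero_le_power2[of "norm (y - x)"] unfolding real_norm_def by linarith
  then have bnd: "norm (e y) / norm (y - x) \<le> 2 * norm (y - x)" for y
    by (cases "y = x") (simp_all add: divide_le_eq power2_eq_square mult.assoc)
  have "((\<lambda>y. norm (e y) / norm (y - x)) \<longlongrightarrow> 0) (at x)"
  proof (rule tendsto_sandwich[OF _ _ tendsto_const])
    show "((\<lambda>y. 2 * norm (y - x)) \<longlongrightarrow> 0) (at x)"
      by (auto intro!: tendsto_eq_intros)
  qed (use bnd in auto)
  then show ?thesis
    unfolding gderiv_def has_derivative_iff_norm inf p_def[symmetric]
    using bounded_linear_inner_left[of "2 *\<^sub>R (x - p x)"] by (simp add: e_def)
qed

text \<open>The gradient of the penalty function in the explicit form in which the algorithm evaluates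
  it.\<close>

lemma gradient_penalty_fun:
  fixes f :: "real ^ 'n \<Rightarrow> real" and G :: "real ^ 'n \<Rightarrow> real ^ 'm"
  assumes f: "continuously_differentiable f" and G: "continuously_differentiable G"
    and A: "continuously_differentiable A"
    and C: "closed C" "convex C" "C \<noteq> {}"
  shows "gradient (penalty_fun f G C A \<beta>) x =
    transpose (jac A x) *v gradient f (A x) +
    \<beta> *\<^sub>R (transpose (jac G x) *v (G x - closest_point C (G x)))"
proof (rule gradient_eqI)
  obtain f' where f': "(f has_derivative f') (at (A x))"
    using f unfolding continuously_differentiable_def by blast
  interpret f': linear f' using f' has_derivative_linear by blast
  have "f' = (\<lambda>h. h \<bullet> adjoint f' 1)"
    using adjoint_works[OF f'.linear_axioms, of _ 1] by (auto simp: fun_eq_iff)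
  then have "GDERIV f (A x) :> adjoint f' 1"
    using f' by (simp add: gderiv_def)
  moreover from this have "gradient f (A x) = adjoint f' 1"
    by (rule gradient_eqI)
  ultimately have f1: "(f has_derivative (\<lambda>h. h \<bullet> gradient f (A x))) (at (A x))"
    by (simp add: gderiv_def)
  have A1: "(A has_derivative (\<lambda>h. jac A x *v h)) (at x)"
  proof -
    have "A differentiable (at x)"
      using A differentiableI unfolding continuously_differentiable_def by blast
    then show ?thesis by (simp only: jacobian_works)
  qed
  have G1: "(G has_derivative (\<lambda>h. jac G x *v h)) (at x)"
  proof -
    have "G differentiable (at x)"
      using G differentiableI unfolding continuously_differentiable_def by blast
    then show ?thesis by (simp only: jacobian_works)
  qed
  have d1: "((\<lambda>y. (infdist y C)\<^sup>2) has_derivative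
      (\<lambda>h. h \<bullet> (2 *\<^sub>R (G x - closest_point C (G x))))) (at (G x))"
    using GDERIV_infdist_sq[OF C] by (simp only: gderiv_def)
  have "((\<lambda>y. f (A y) + \<beta> / 2 * (infdist (G y) C)\<^sup>2) has_derivative
     (\<lambda>h. (jac A x *v h) \<bullet> gradient f (A x) +
        \<beta> / 2 * ((jac G x *v h) \<bullet> (2 *\<^sub>R (G x - closest_point C (G x)))))) (at x)"
    by (intro has_derivative_add has_derivative_mult_right
        has_derivative_compose[OF A1 f1] has_derivative_compose[OF G1 d1])
  moreover have adj: "(M *v h) \<bullet> u = h \<bullet> (transpose M *v u)"
    for M :: "real ^ 'n ^ 'k" and h u
    by (metis dot_lmul_matrix inner_commute transpose_matrix_vector)
  ultimately show "GDERIV (penalty_fun f G C A \<beta>) x :>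
    transpose (jac A x) *v gradient f (A x) +
    \<beta> *\<^sub>R (transpose (jac G x) *v (G x - closest_point C (G x)))"
    unfolding gderiv_def penalty_fun_def
    by (simp del: transpose_matrix_vector add: inner_add_right adj)
qed

end

theory Submission
  imports Defs
begin

text \<open>
  Write \<open>T\<close> and \<open>J\<close> for the transposed Jacobians of \<open>A\<close> and \<open>G\<close> at \<open>xbar\<close>, and \<open>g\<close> for the gradient
  of \<open>f\<close> at \<open>xbar\<close>.

  The method minimizes a penalized form of \<open>f \<circ> A\<close>, so all that it yields directly is stationarity
  of \<open>xbar\<close> for \<open>f \<circ> A\<close>: the scaled residuals \<open>\<beta>\<^sub>k (G x\<^sub>k - P\<^sub>C (G x\<^sub>k))\<close> are normal to \<open>C\<close> at a
  point close to \<open>G x\<^sub>k\<close>, so the penalty stationarity condition puts \<open>- T g\<close> into the outer limit of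
  the map in the definition of AM-regularity (\<open>penalty_sequence_limit\<close>), and regularity gives
  \<open>- T g = J \<lambda> + \<zeta>\<close> with \<open>\<lambda>\<close> normal to \<open>C\<close> and \<open>\<zeta>\<close> a limiting normal to \<open>D\<close>.

  To get from \<open>f \<circ> A\<close> back to \<open>f\<close>, note that \<open>f - f \<circ> A\<close> vanishes on the feasible set, so that
  \<open>xbar\<close> minimizes it there. A local minimizer is itself a limit of stationary points of penalty
  functions (\<open>local_minimizer_outer_limit\<close>), and so, by AM-regularity again,
  \<open>T g - g = J \<mu> + \<eta>\<close> with \<open>\<mu>\<close> and \<open>\<eta>\<close> normal to \<open>C\<close> and \<open>D\<close> as before.

  Adding the two equations is not enough, since the limiting normal cone of \<open>D\<close> need not be convex
  and \<open>\<zeta> + \<eta>\<close> may lie outside it. Here the remaining properties of \<open>A\<close> enter: at \<open>xbar\<close>, \<open>T\<close>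
  annihilates the vectors \<open>J v\<close> with \<open>v\<close> normal to \<open>C\<close> and fixes the limiting normals of \<open>D\<close>.
  Applying \<open>T\<close> to both equations gives \<open>- T (T g) = \<zeta>\<close> and \<open>T (T g) - T g = \<eta>\<close>, hence
  \<open>\<eta> = - \<zeta> - T g = J \<lambda>\<close>. So \<open>\<eta>\<close> can be moved to the side of \<open>C\<close>, whose normal cone is closed under
  addition: \<open>- g = J (\<mu> + 2 \<lambda>) + \<zeta>\<close>.
\<close>

section \<open>Continuously differentiable maps\<close>

lemma continuously_differentiable_imp_differentiable:
  "continuously_differentiable g \<Longrightarrow> g differentiable (at x)"
  unfolding continuously_differentiable_def by (blast intro: differentiableI)

lemma continuously_differentiable_imp_tendsto:
  assumes "continuously_differentiable g" "xs \<longlonglongrightarrow> x"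
  shows "(\<lambda>k. g (xs k)) \<longlonglongrightarrow> g x"
  using differentiable_imp_continuous_within[OF continuously_differentiable_imp_differentiable[OF assms(1)]]
    assms(2) by (rule isCont_tendsto_compose)

lemma continuously_differentiable_id: "continuously_differentiable (\<lambda>x. x)"
  unfolding continuously_differentiable_def
  by (rule exI[of _ "\<lambda>_. id_blinfun"]) simp

lemma continuously_differentiable_diff:
  assumes "continuously_differentiable f" "continuously_differentiable g"
  shows "continuously_differentiable (\<lambda>x. f x - g x)"
proof -
  obtain f' g' where "\<And>x. (f has_derivative blinfun_apply (f' x)) (at x)" "continuous_on UNIV f'"
    "\<And>x. (g has_derivative blinfun_apply (g' x)) (at x)" "continuous_on UNIV g'"
    using assms unfolding continuously_differentiable_def by blast
  then show ?thesis
    unfolding continuously_differentiable_def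
    by (intro exI[of _ "\<lambda>x. f' x - g' x"])
      (simp add: has_derivative_diff continuous_on_diff minus_blinfun.rep_eq)
qed

lemma continuously_differentiable_compose:
  assumes "continuously_differentiable f" "continuously_differentiable g"
  shows "continuously_differentiable (\<lambda>x. f (g x))"
proof -
  obtain f' g' where f': "\<And>x. (f has_derivative blinfun_apply (f' x)) (at x)" "continuous_on UNIV f'"
    and g': "\<And>x. (g has_derivative blinfun_apply (g' x)) (at x)" "continuous_on UNIV g'"
    using assms unfolding continuously_differentiable_def by blast
  have "continuous_on UNIV g"
    using g'(1) has_derivative_continuous by (blast intro: continuous_at_imp_continuous_on)
  then have "continuous_on UNIV (\<lambda>x. f' (g x) o\<^sub>L g' x)"
    by (intro bounded_bilinear.continuous_on[OF bounded_bilinear_blinfun_compose] g'(2)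
        continuous_on_compose2[OF f'(2)]) auto
  moreover have "((\<lambda>x. f (g x)) has_derivative blinfun_apply (f' (g x) o\<^sub>L g' x)) (at x)" for x
    using has_derivative_compose[OF g'(1) f'(1)] by (simp add: blinfun_compose.rep_eq o_def)
  ultimately show ?thesis
    unfolding continuously_differentiable_def by (intro exI[of _ "\<lambda>x. f' (g x) o\<^sub>L g' x"]) simp
qed

lemma GDERIV_gradient:
  fixes f :: "real ^ 'n \<Rightarrow> real"
  assumes "f differentiable (at x)"
  shows "GDERIV f x :> gradient f x"
proof -
  obtain f' where f': "(f has_derivative f') (at x)"
    using assms unfolding differentiable_def by blast
  have "f' = (\<lambda>h. h \<bullet> adjoint f' 1)"
    using adjoint_works[OF has_derivative_linear[OF f'], of _ 1] by (auto simp: fun_eq_iff)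
  with f' have "GDERIV f x :> adjoint f' 1"
    by (simp add: gderiv_def)
  with gradient_eqI show ?thesis by metis
qed

lemma gradient_compose:
  fixes f :: "real ^ 'm \<Rightarrow> real" and A :: "real ^ 'n \<Rightarrow> real ^ 'm"
  assumes "f differentiable (at (A x))" "A differentiable (at x)"
  shows "gradient (\<lambda>y. f (A y)) x = transpose (jac A x) *v gradient f (A x)"
proof (rule gradient_eqI)
  have "(A has_derivative (\<lambda>h. jac A x *v h)) (at x)"
    using assms(2) by (simp only: jacobian_works)
  moreover have "(f has_derivative (\<lambda>h. h \<bullet> gradient f (A x))) (at (A x))"
    using GDERIV_gradient[OF assms(1)] by (simp only: gderiv_def)
  ultimately have "((\<lambda>y. f (A y)) has_derivative (\<lambda>h. (jac A x *v h) \<bullet> gradient f (A x))) (at x)"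
    by (rule has_derivative_compose)
  moreover have "(jac A x *v h) \<bullet> u = h \<bullet> (transpose (jac A x) *v u)" for h u
    by (metis dot_lmul_matrix inner_commute transpose_matrix_vector)
  ultimately show "GDERIV (\<lambda>y. f (A y)) x :> transpose (jac A x) *v gradient f (A x)"
    unfolding gderiv_def by (simp del: transpose_matrix_vector)
qed

lemma gradient_diff:
  fixes f :: "real ^ 'n \<Rightarrow> real"
  assumes "f differentiable (at x)" "g differentiable (at x)"
  shows "gradient (\<lambda>y. f y - g y) x = gradient f x - gradient g x"
  by (intro gradient_eqI GDERIV_diff GDERIV_gradient assms)

lemma tendsto_gradient:
  fixes f :: "real ^ 'n \<Rightarrow> real"
  assumes f: "continuously_differentiable f" and xs: "xs \<longlonglongrightarrow> x"
  shows "(\<lambda>k. gradient f (xs k)) \<longlonglongrightarrow> gradient f x"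
proof -
  obtain f' where f': "\<And>y. (f has_derivative blinfun_apply (f' y)) (at y)" "continuous_on UNIV f'"
    using f unfolding continuously_differentiable_def by blast
  have "gradient f y $ i = f' y (axis i 1)" for y i
  proof -
    have "(\<lambda>h. h \<bullet> gradient f y) = blinfun_apply (f' y)"
      using GDERIV_gradient[OF differentiableI[OF f'(1)]] f'(1) unfolding gderiv_def
      by (rule has_derivative_unique)
    then show ?thesis by (metis inner_axis' inner_real_def lambda_one)
  qed
  moreover have "(\<lambda>k. f' (xs k)) \<longlonglongrightarrow> f' x"
    using continuous_on_tendsto_compose[OF f'(2) xs] by simp
  ultimately show ?thesis
    by (intro vec_tendstoI) (auto intro!: tendsto_eq_intros)
qed

lemma tendsto_jac:
  fixes g :: "real ^ 'n \<Rightarrow> real ^ 'm"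
  assumes g: "continuously_differentiable g" and xs: "xs \<longlonglongrightarrow> x"
  shows "(\<lambda>k. jac g (xs k)) \<longlonglongrightarrow> jac g x"
proof -
  obtain g' where g': "\<And>y. (g has_derivative blinfun_apply (g' y)) (at y)" "continuous_on UNIV g'"
    using g unfolding continuously_differentiable_def by blast
  have "jac g y $ i $ j = g' y (axis j 1) $ i" for y i j
    unfolding jacobian_def using frechet_derivative_at[OF g'(1)[of y]] by (simp add: matrix_def)
  moreover have "(\<lambda>k. g' (xs k)) \<longlonglongrightarrow> g' x"
    using continuous_on_tendsto_compose[OF g'(2) xs] by simp
  ultimately show ?thesis
    by (intro vec_tendstoI) (auto intro!: tendsto_eq_intros)
qed

lemma tendsto_transpose_mult:
  fixes M :: "nat \<Rightarrow> real ^ 'n ^ 'm"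
  assumes "M \<longlonglongrightarrow> M'" "v \<longlonglongrightarrow> v'"
  shows "(\<lambda>k. transpose (M k) *v v k) \<longlonglongrightarrow> transpose M' *v v'"
  unfolding matrix_vector_mult_def transpose_def
  by (intro vec_tendstoI) (auto intro!: tendsto_eq_intros assms)

lemma penalty_fun_differentiable:
  fixes G :: "real ^ 'n \<Rightarrow> real ^ 'm"
  assumes f: "continuously_differentiable f" and G: "continuously_differentiable G"
    and A: "continuously_differentiable A"
    and C: "closed C" "convex C" "C \<noteq> {}"
  shows "penalty_fun f G C A \<beta> differentiable (at x)"
proof -
  have "(\<lambda>y. (infdist y C)\<^sup>2) differentiable (at (G x))"
    using GDERIV_infdist_sq[OF C] unfolding gderiv_def by (rule differentiableI)
  then have "(\<lambda>y. (infdist (G y) C)\<^sup>2) differentiable (at x)"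
    using differentiable_chain_at[OF continuously_differentiable_imp_differentiable[OF G, of x]]
    by (fastforce simp: o_def)
  moreover have "(\<lambda>y. f (A y)) differentiable (at x)"
    using continuously_differentiable_compose[OF f A]
    by (rule continuously_differentiable_imp_differentiable)
  ultimately show ?thesis
    unfolding penalty_fun_def by (intro differentiable_add differentiable_mult) auto
qed

section \<open>Normal cones\<close>

lemma normal_cone_add:
  assumes "v \<in> normal_cone S z" "w \<in> normal_cone S z"
  shows "v + w \<in> normal_cone S z"
  unfolding normal_cone_def
proof (intro CollectI conjI allI impI)
  fix \<epsilon> :: real assume "\<epsilon> > 0"
  then have "\<epsilon> / 2 > 0" by simp
  then obtain \<delta>1 \<delta>2 where "\<delta>1 > 0" "\<delta>2 > 0"
    and d: "\<forall>x\<in>S. norm (x - z) < \<delta>1 \<longrightarrow> v \<bullet> (x - z) \<le> \<epsilon> / 2 * norm (x - z)"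
    "\<forall>x\<in>S. norm (x - z) < \<delta>2 \<longrightarrow> w \<bullet> (x - z) \<le> \<epsilon> / 2 * norm (x - z)"
    using assms unfolding normal_cone_def by blast
  have "(v + w) \<bullet> (x - z) \<le> \<epsilon> * norm (x - z)"
    if "x \<in> S" "norm (x - z) < min \<delta>1 \<delta>2" for x
    using d(1)[rule_format, OF that(1)] d(2)[rule_format, OF that(1)] that(2)
    unfolding inner_add_left by simp
  with \<open>\<delta>1 > 0\<close> \<open>\<delta>2 > 0\<close>
  show "\<exists>\<delta>>0. \<forall>x\<in>S. norm (x - z) < \<delta> \<longrightarrow> (v + w) \<bullet> (x - z) \<le> \<epsilon> * norm (x - z)"
    by (intro exI[of _ "min \<delta>1 \<delta>2"]) simp
qed (use assms in \<open>simp add: normal_cone_def\<close>)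

lemma normal_cone_subset_lim_normal_cone: "normal_cone S z \<subseteq> lim_normal_cone S z"
proof
  fix v assume v: "v \<in> normal_cone S z"
  then have "z \<in> S" by (simp add: normal_cone_def)
  with v show "v \<in> lim_normal_cone S z"
    unfolding lim_normal_cone_def
    by (intro CollectI conjI exI[of _ "\<lambda>_. z"] exI[of _ "\<lambda>_. v"]) auto
qed

text \<open>These vectors are the multipliers of the penalty method, normal at the projection rather than
  at the projected point.\<close>

lemma projection_residual_in_normal_cone:
  fixes C :: "'a::euclidean_space set"
  assumes C: "closed C" "convex C" "C \<noteq> {}" and "\<beta> \<ge> 0"
  shows "\<beta> *\<^sub>R (y - closest_point C y) \<in> normal_cone C (closest_point C y)"
proof -
  have "\<beta> *\<^sub>R (y - closest_point C y) \<bullet> (x - closest_point C y) \<le> \<epsilon> * norm (x - closest_point C y)"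
    if "x \<in> C" "\<epsilon> > 0" for x \<epsilon>
  proof -
    have "\<beta> * ((y - closest_point C y) \<bullet> (x - closest_point C y)) \<le> 0"
      using closest_point_dot[OF C(2,1) that(1)] \<open>\<beta> \<ge> 0\<close> by (rule mult_nonneg_nonpos[rotated])
    also have "0 \<le> \<epsilon> * norm (x - closest_point C y)"
      using that(2) by simp
    finally show ?thesis by simp
  qed
  then show ?thesis
    unfolding normal_cone_def using closest_point_in_set[OF C(1,3)]
    by (auto intro: exI[of _ 1])
qed

text \<open>Fermat's rule on a set: the first-order expansion of \<open>h\<close> at \<open>z\<close> can decrease along \<open>S\<close> only
  by its error term.\<close>

lemma neg_gradient_in_normal_cone:
  assumes g: "GDERIV h z :> g" and "z \<in> S" "\<delta> > 0"
    and min: "\<And>y. y \<in> S \<Longrightarrow> norm (y - z) < \<delta> \<Longrightarrow> h z \<le> h y"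
  shows "- g \<in> normal_cone S z"
  unfolding normal_cone_def
proof (intro CollectI conjI allI impI)
  fix \<epsilon> :: real assume "\<epsilon> > 0"
  then obtain d where "d > 0"
    and d: "\<And>y. norm (y - z) < d \<Longrightarrow> \<bar>h y - h z - (y - z) \<bullet> g\<bar> \<le> \<epsilon> * norm (y - z)"
    using g unfolding gderiv_def has_derivative_at_alt real_norm_def by blast
  have "- g \<bullet> (y - z) \<le> \<epsilon> * norm (y - z)" if "y \<in> S" "norm (y - z) < min d \<delta>" for y
  proof -
    have "h z \<le> h y" "\<bar>h y - h z - (y - z) \<bullet> g\<bar> \<le> \<epsilon> * norm (y - z)"
      using that by (auto intro: min d)
    then show ?thesis
      unfolding inner_minus_left inner_commute[of g] by linarith
  qed
  then show "\<exists>\<delta>>0. \<forall>y\<in>S. norm (y - z) < \<delta> \<longrightarrow> - g \<bullet> (y - z) \<le> \<epsilon> * norm (y - z)"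
    using \<open>d > 0\<close> \<open>\<delta> > 0\<close> by (intro exI[of _ "min d \<delta>"]) simp
qed (fact \<open>z \<in> S\<close>)

section \<open>Asymptotic stationarity of penalty sequences\<close>

text \<open>Shifting \<open>G (xs k)\<close> by its projection residual \<open>z k\<close> lands in \<open>C\<close>, where \<open>b k\<close> times the residual is
  a normal. The shift is allowed because \<open>M_map\<close> perturbs the argument of the normal cone, and it
  tends to \<open>0\<close> because the limit point satisfies \<open>G xbar \<in> C\<close>. The multipliers themselves may be
  unbounded; only their combination with normals of \<open>D\<close> converges. The map \<open>A\<close> is general so that the lemma
  serves both the given dissolving map and the identity.\<close>

lemma penalty_sequence_limit:
  fixes f :: "real ^ 'n \<Rightarrow> real" and G :: "real ^ 'n \<Rightarrow> real ^ 'm"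
  assumes f: "continuously_differentiable f" and G: "continuously_differentiable G"
    and A: "continuously_differentiable A"
    and C: "closed C" "convex C" "C \<noteq> {}"
    and xs: "xs \<longlonglongrightarrow> xbar" and Gx: "G xbar \<in> C"
    and es: "es \<longlonglongrightarrow> 0" and b: "\<And>k. b k \<ge> 0"
    and stat: "\<And>k. es k \<in> {gradient (penalty_fun f G C A (b k)) (xs k)} + lim_normal_cone D (xs k)"
  shows "- gradient (\<lambda>y. f (A y)) xbar \<in> outer_limit (M_map G C D) (xbar, 0)"
proof -
  define g where "g y = transpose (jac A y) *v gradient f (A y)" for y
  have grad: "gradient (\<lambda>y. f (A y)) y = g y" for y
    unfolding g_def by (intro gradient_compose continuously_differentiable_imp_differentiable f A)
  define z where "z k = G (xs k) - closest_point C (G (xs k))" for k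
  have "(\<lambda>k. G (xs k)) \<longlonglongrightarrow> G xbar"
    by (rule continuously_differentiable_imp_tendsto[OF G xs])
  then have "z \<longlonglongrightarrow> G xbar - closest_point C (G xbar)"
    unfolding z_def
    by (intro tendsto_diff isCont_tendsto_compose[OF continuous_at_closest_point[OF C(2,1,3)]])
  then have z: "z \<longlonglongrightarrow> 0"
    using closest_point_self[OF Gx] by simp
  have "(\<lambda>k. g (xs k)) \<longlonglongrightarrow> g xbar"
    unfolding g_def
    by (intro tendsto_transpose_mult tendsto_jac[OF A xs]
        tendsto_gradient[OF f continuously_differentiable_imp_tendsto[OF A xs]])
  with es have lim: "(\<lambda>k. es k - g (xs k)) \<longlonglongrightarrow> - g xbar"
    by (auto intro!: tendsto_eq_intros)
  have "es k - g (xs k) \<in> M_map G C D (xs k, z k)" for k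
  proof -
    obtain \<zeta> where \<zeta>: "\<zeta> \<in> lim_normal_cone D (xs k)"
      and "es k = gradient (penalty_fun f G C A (b k)) (xs k) + \<zeta>"
      using stat[of k] by (auto simp: set_plus_def)
    then have eq: "es k - g (xs k) = transpose (jac G (xs k)) *v (b k *\<^sub>R z k) + \<zeta>"
      unfolding gradient_penalty_fun[OF f G A C] g_def z_def matrix_vector_mult_scaleR
      by (simp del: transpose_matrix_vector)
    have "b k *\<^sub>R z k \<in> normal_cone C (G (xs k) - z k)"
      using projection_residual_in_normal_cone[OF C b] by (simp add: z_def)
    with \<zeta> show ?thesis
      unfolding eq M_map_def mat_image_def by (auto simp del: transpose_matrix_vector)
  qed
  with lim show ?thesis
    unfolding outer_limit_def grad using tendsto_Pair[OF xs z]
    by (intro CollectI exI[of _ "\<lambda>k. (xs k, z k)"] exI[of _ "\<lambda>k. es k - g (xs k)"]) simp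
qed

section \<open>Local minimizers are asymptotically stationary\<close>

text \<open>Adding the proximal term \<open>(norm (y - xbar))\<^sup>2 / 2\<close> to the penalized objective makes \<open>xbar\<close> a strict
  minimizer, so minimizers \<open>u k\<close> of the penalized problems over a compact neighbourhood can only
  cluster at \<open>xbar\<close>. Being eventually interior to the neighbourhood, they satisfy the
  stationarity condition of \<open>penalty_sequence_limit\<close>, with \<open>A\<close> the identity and with the vanishing
  gradient of the proximal term as the error.\<close>

lemma local_minimizer_outer_limit:
  fixes f :: "real ^ 'n \<Rightarrow> real" and G :: "real ^ 'n \<Rightarrow> real ^ 'm"
  assumes f: "continuously_differentiable f" and G: "continuously_differentiable G"
    and C: "closed C" "convex C" "C \<noteq> {}" and D: "closed D"
    and xbar: "xbar \<in> feasible G C D" and "\<delta> > 0"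
    and min: "\<And>y. y \<in> feasible G C D \<Longrightarrow> dist xbar y \<le> \<delta> \<Longrightarrow> f xbar \<le> f y"
  shows "- gradient f xbar \<in> outer_limit (M_map G C D) (xbar, 0)"
proof -
  define q where "q k y = penalty_fun f G C (\<lambda>y. y) (real k) y + (norm (y - xbar))\<^sup>2 / 2" for k y
  define K where "K = D \<inter> cball xbar \<delta>"
  have K: "compact K" "xbar \<in> K"
    using D xbar \<open>\<delta> > 0\<close> by (auto simp: K_def feasible_def intro: closed_Int_compact)
  have sq: "GDERIV (\<lambda>y. (norm (y - xbar))\<^sup>2 / 2) y :> y - xbar" for y
    unfolding gderiv_def power2_norm_eq_inner
    by (auto intro!: derivative_eq_intros simp: inner_commute)
  have q': "GDERIV (q k) y :> gradient (penalty_fun f G C (\<lambda>y. y) (real k)) y + (y - xbar)" for k y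
    unfolding q_def
    by (intro GDERIV_add sq GDERIV_gradient
        penalty_fun_differentiable[OF f G continuously_differentiable_id C])
  then have "continuous_on K (q k)" for k
    unfolding gderiv_def by (meson continuous_at_imp_continuous_on has_derivative_continuous)
  then have "\<exists>u\<in>K. \<forall>y\<in>K. q k u \<le> q k y" for k
    using continuous_attains_inf[OF K(1)] K(2) by blast
  then obtain u where u: "\<And>k. u k \<in> K" "\<And>k y. y \<in> K \<Longrightarrow> q k (u k) \<le> q k y"
    by metis
  obtain l r where "l \<in> K" and r: "strict_mono r" "(u \<circ> r) \<longlonglongrightarrow> l"
    using K(1) u(1) unfolding compact_def by blast
  have ul: "(\<lambda>k. u (r k)) \<longlonglongrightarrow> l" using r(2) by (simp add: o_def)
  have Gxbar: "infdist (G xbar) C = 0"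
    using xbar by (simp add: feasible_def)
  have bound: "f (u k) + real k / 2 * (infdist (G (u k)) C)\<^sup>2 + (norm (u k - xbar))\<^sup>2 / 2 \<le> f xbar" for k
    using u(2)[OF K(2), of k] by (simp add: q_def penalty_fun_def Gxbar)
  have flim: "(\<lambda>k. f (u (r k))) \<longlonglongrightarrow> f l"
    by (rule continuously_differentiable_imp_tendsto[OF f ul])
  have "f (u (r k)) + (norm (u (r k) - xbar))\<^sup>2 / 2 \<le> f xbar" for k
  proof -
    have "0 \<le> real (r k) / 2 * (infdist (G (u (r k))) C)\<^sup>2" by simp
    with bound[of "r k"] show ?thesis by linarith
  qed
  moreover have "(\<lambda>k. f (u (r k)) + (norm (u (r k) - xbar))\<^sup>2 / 2) \<longlonglongrightarrow> f l + (norm (l - xbar))\<^sup>2 / 2"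
    by (intro tendsto_intros flim ul) auto
  ultimately have fl: "f l + (norm (l - xbar))\<^sup>2 / 2 \<le> f xbar"
    by (intro LIMSEQ_le_const2) auto
  \<comment> \<open>\<open>bound\<close> leaves room for a squared distance of order \<open>1 / k\<close> only, as \<open>f\<close> converges along the
    subsequence.\<close>
  have "infdist (G l) C = 0"
  proof -
    have dlim: "(\<lambda>k. (infdist (G (u (r k))) C)\<^sup>2) \<longlonglongrightarrow> (infdist (G l) C)\<^sup>2"
      by (intro tendsto_intros continuously_differentiable_imp_tendsto[OF G ul])
    have "(infdist (G (u (r k))) C)\<^sup>2 \<le> 2 * (f xbar - f (u (r k))) * inverse (real k)" if "k \<ge> 1" for k
    proof -
      have "real k * (infdist (G (u (r k))) C)\<^sup>2 \<le> real (r k) * (infdist (G (u (r k))) C)\<^sup>2"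
        using seq_suble[OF r(1), of k] by (intro mult_right_mono) auto
      also have "\<dots> \<le> 2 * (f xbar - f (u (r k)))"
        using bound[of "r k"] zero_le_power2[of "norm (u (r k) - xbar)"] by argo
      finally show ?thesis using that by (simp add: field_simps)
    qed
    moreover have "(\<lambda>k. 2 * (f xbar - f (u (r k))) * inverse (real k)) \<longlonglongrightarrow> 2 * (f xbar - f l) * 0"
      by (intro tendsto_intros flim lim_inverse_n)
    ultimately have "(infdist (G l) C)\<^sup>2 \<le> 2 * (f xbar - f l) * 0"
      by (intro LIMSEQ_le[OF dlim]) auto
    then show ?thesis by simp
  qed
  then have "G l \<in> C"
    using in_closed_iff_infdist_zero[OF C(1,3)] by simp
  then have "f xbar \<le> f l"
    using \<open>l \<in> K\<close> by (intro min) (auto simp: K_def feasible_def)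
  with fl have "(norm (l - xbar))\<^sup>2 \<le> 0" by argo
  then have "l = xbar" by simp
  with ul have lim: "(\<lambda>k. u (r k)) \<longlonglongrightarrow> xbar" by simp
  then obtain N where N: "\<And>k. k \<ge> N \<Longrightarrow> dist (u (r k)) xbar < \<delta>"
    using \<open>\<delta> > 0\<close> unfolding lim_sequentially by blast
  define v where "v k = u (r (k + N))" for k
  have v: "v \<longlonglongrightarrow> xbar"
    unfolding v_def using LIMSEQ_ignore_initial_segment[OF lim] .
  have "xbar - v k \<in> {gradient (penalty_fun f G C (\<lambda>y. y) (real (r (k + N)))) (v k)}
      + lim_normal_cone D (v k)" for k
  proof -
    have "- (gradient (penalty_fun f G C (\<lambda>y. y) (real (r (k + N)))) (v k) + (v k - xbar))
        \<in> normal_cone D (v k)"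
    proof (rule neg_gradient_in_normal_cone[OF q'])
      show "v k \<in> D" using u(1) by (simp add: v_def K_def)
      \<comment> \<open>Within this distance of \<open>v k\<close>, points of \<open>D\<close> still compete in the minimization over \<open>K\<close>.\<close>
      show "\<delta> - dist (v k) xbar > 0" using N[of "k + N"] by (simp add: v_def)
      fix y assume "y \<in> D" "norm (y - v k) < \<delta> - dist (v k) xbar"
      then have "y \<in> K"
        using dist_triangle[of xbar y "v k"] by (simp add: K_def dist_norm norm_minus_commute)
      then show "q (r (k + N)) (v k) \<le> q (r (k + N)) y"
        unfolding v_def by (rule u(2))
    qed
    then show ?thesis
      using normal_cone_subset_lim_normal_cone by (force simp: set_plus_def)
  qed
  moreover have "(\<lambda>k. xbar - v k) \<longlonglongrightarrow> 0"
    using v by (auto intro!: tendsto_eq_intros)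
  ultimately show ?thesis
    using penalty_sequence_limit[OF f G continuously_differentiable_id C v, of "\<lambda>k. xbar - v k"
        "\<lambda>k. real (r (k + N))" D] xbar by (simp add: feasible_def)
qed

section \<open>From the dissolved problem to the original one\<close>

theorem theorem3p3:
  fixes f :: "real ^ 'n \<Rightarrow> real"
    and G :: "real ^ 'n \<Rightarrow> real ^ 'm"
    and C :: "(real ^ 'm) set"
    and D :: "(real ^ 'n) set"
    and A :: "real ^ 'n \<Rightarrow> real ^ 'n"
    and x eps :: "nat \<Rightarrow> real ^ 'n"
    and \<beta> :: "nat \<Rightarrow> real"
    and xbar :: "real ^ 'n"
  assumes "continuously_differentiable f"
    and "continuously_differentiable G"
    and "C \<noteq> {}" "closed C" "convex C"
    and "D \<noteq> {}" "closed D"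
    and "\<forall>y \<in> feasible G C D. AM_regular G C D y"
    and "constraint_dissolving G C D A"
    and "generated_by_CDIPM f G C D A x eps \<beta>"
    and "eps \<longlonglongrightarrow> 0"
    and "filterlim \<beta> at_top sequentially"
    and "accumulation_point x xbar"
    and "xbar \<in> feasible G C D"
  shows "M_stationary f G C D xbar"
proof -
  note f = assms(1) and G = assms(2) and C = assms(4,5,3) and xbar = assms(14)
  have A: "continuously_differentiable A"
    and A_id: "\<And>y. y \<in> feasible G C D \<Longrightarrow> A y = y"
    using assms(9) by (auto simp: constraint_dissolving_def)
  have fA: "continuously_differentiable (\<lambda>y. f (A y))"
    by (rule continuously_differentiable_compose[OF f A])
  note diff = continuously_differentiable_imp_differentiable
  define T where "T = transpose (jac A xbar)"
  define J where "J = transpose (jac G xbar)"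
  have M: "outer_limit (M_map G C D) (xbar, 0) \<subseteq> M_map G C D (xbar, 0)"
    using assms(8) xbar by (simp add: AM_regular_def)
  have M_E: "\<exists>lam \<zeta>. lam \<in> normal_cone C (G xbar) \<and> \<zeta> \<in> lim_normal_cone D xbar \<and> w = J *v lam + \<zeta>"
    if "w \<in> outer_limit (M_map G C D) (xbar, 0)" for w
    using subsetD[OF M that] unfolding M_map_def mat_image_def J_def
    by (auto simp: set_plus_def simp del: transpose_matrix_vector)
  have grad_fA: "gradient (\<lambda>y. f (A y)) xbar = T *v gradient f xbar"
    unfolding T_def using gradient_compose[of f A xbar] diff[OF f] diff[OF A] A_id[OF xbar] by simp

  have "- gradient (\<lambda>y. f (A y)) xbar \<in> outer_limit (M_map G C D) (xbar, 0)"
  proof -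
    obtain r where r: "strict_mono r" "(x \<circ> r) \<longlonglongrightarrow> xbar"
      using assms(13) unfolding accumulation_point_def by blast
    \<comment> \<open>Starting the subsequence at \<open>r 1 \<ge> 1\<close> skips the initial iterate, which obeys no stationarity
      condition, and makes all its indices successors.\<close>
    define n where "n k = r (Suc k) - 1" for k
    have n: "r (Suc k) = Suc (n k)" for k
      using seq_suble[OF r(1), of "Suc k"] by (simp add: n_def)
    have "(\<lambda>k. x (Suc (n k))) \<longlonglongrightarrow> xbar"
      using LIMSEQ_Suc[OF r(2)] by (simp add: n)
    moreover have "(\<lambda>k. eps (Suc (n k))) \<longlonglongrightarrow> 0"
      using LIMSEQ_Suc[OF LIMSEQ_subseq_LIMSEQ[OF assms(11) r(1)]] by (simp add: n)
    moreover have "\<beta> k \<ge> 0" for k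
      using assms(10) lift_Suc_mono_le[of \<beta> 0 k] unfolding generated_by_CDIPM_def by fastforce
    moreover have "eps (Suc k) \<in>
        {gradient (penalty_fun f G C A (\<beta> k)) (x (Suc k))} + lim_normal_cone D (x (Suc k))" for k
      using assms(10) unfolding generated_by_CDIPM_def by blast
    ultimately show ?thesis
      using xbar by (intro penalty_sequence_limit[OF f G A C, where b = "\<lambda>k. \<beta> (n k)"])
        (auto simp: feasible_def)
  qed
  then obtain lam \<zeta> where lam: "lam \<in> normal_cone C (G xbar)" and zeta: "\<zeta> \<in> lim_normal_cone D xbar"
    and eq1: "- (T *v gradient f xbar) = J *v lam + \<zeta>"
    using M_E grad_fA by metis

  have "- gradient (\<lambda>y. f y - f (A y)) xbar \<in> outer_limit (M_map G C D) (xbar, 0)"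
    by (rule local_minimizer_outer_limit[OF continuously_differentiable_diff[OF f fA] G C assms(7) xbar
          zero_less_one]) (simp add: A_id xbar)
  then obtain \<mu> \<eta> where mu: "\<mu> \<in> normal_cone C (G xbar)" and eta: "\<eta> \<in> lim_normal_cone D xbar"
    and eq2: "T *v gradient f xbar - gradient f xbar = J *v \<mu> + \<eta>"
    using M_E unfolding gradient_diff[OF diff[OF f] diff[OF fA]] grad_fA minus_diff_eq by meson

  have TJ: "T *v (J *v v) = 0" if "v \<in> normal_cone C (G xbar)" for v
  proof -
    have "mat_image T (mat_image J (normal_cone C (G xbar))) = {0}"
      using assms(9) xbar unfolding constraint_dissolving_def T_def J_def by meson
    moreover have "T *v (J *v v) \<in> mat_image T (mat_image J (normal_cone C (G xbar)))"
      unfolding mat_image_def by (intro imageI that)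
    ultimately show ?thesis by simp
  qed
  have T_normal: "T *v v = v" if v: "v \<in> lim_normal_cone D xbar" for v
  proof -
    obtain R \<omega> where "R xbar = (0 :: real ^ 'n ^ 'n)" "\<omega> > 0"
      "\<forall>y\<in>D. norm (y - xbar) \<le> \<omega> \<longrightarrow>
        mat_image (transpose (jac A y - mat 1 - R y)) (lim_normal_cone D y) = {0}"
      using assms(9) xbar unfolding constraint_dissolving_def by meson
    then have "mat_image (transpose (jac A xbar - mat 1)) (lim_normal_cone D xbar) = {0}"
      using xbar by (auto simp: feasible_def)
    moreover have "transpose (jac A xbar - mat 1) *v v
        \<in> mat_image (transpose (jac A xbar - mat 1)) (lim_normal_cone D xbar)"
      unfolding mat_image_def by (intro imageI v)
    ultimately have "transpose (jac A xbar - mat 1) *v v = 0"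
      by simp
    moreover have "transpose (jac A xbar - mat 1) = T - mat 1"
      by (auto simp: T_def transpose_def mat_def vec_eq_iff)
    ultimately show ?thesis
      by (simp add: matrix_vector_mult_diff_rdistrib)
  qed
  have "T *v (T *v gradient f xbar) = - \<zeta>"
    using arg_cong[OF eq1, of "\<lambda>v. - (T *v v)"] TJ[OF lam] T_normal[OF zeta]
    by (simp add: matrix_vector_right_distrib linear_neg[OF matrix_vector_mul_linear])
  moreover have "T *v (T *v gradient f xbar) - T *v gradient f xbar = \<eta>"
    using arg_cong[OF eq2, of "\<lambda>v. T *v v"] TJ[OF mu] T_normal[OF eta]
    by (simp add: matrix_vector_right_distrib matrix_vector_mult_diff_distrib)
  \<comment> \<open>The limiting normal \<open>\<eta>\<close> is rewritten as an image of a normal of \<open>C\<close>, so that \<open>\<zeta>\<close> is the only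
    limiting normal of \<open>D\<close> that remains.\<close>
  ultimately have "\<eta> = - \<zeta> + - (T *v gradient f xbar)"
    by simp
  then have eta_eq: "\<eta> = J *v lam"
    unfolding eq1 by simp
  have "- gradient f xbar = (T *v gradient f xbar - gradient f xbar) + - (T *v gradient f xbar)"
    by simp
  also have "\<dots> = J *v (\<mu> + lam + lam) + \<zeta>"
    unfolding eq1 eq2 eta_eq matrix_vector_right_distrib by (simp only: add.assoc)
  finally have eq3: "- gradient f xbar = J *v (\<mu> + lam + lam) + \<zeta>" .
  have "0 = gradient f xbar + - gradient f xbar"
    by simp
  also have "\<dots> = (gradient f xbar + J *v (\<mu> + lam + lam)) + \<zeta>"
    unfolding eq3 by (simp only: add.assoc)
  finally have "0 \<in> {gradient f xbar + J *v (\<mu> + lam + lam)} + lim_normal_cone D xbar"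
    using zeta set_plus_intro[OF singletonI] by metis
  moreover have "\<mu> + lam + lam \<in> normal_cone C (G xbar)"
    by (intro normal_cone_add mu lam)
  ultimately show ?thesis
    unfolding M_stationary_def J_def by (rule bexI)
qed

end
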